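(* Suppose that for some $\gamma>0$ and infinitely many positive integers $t$ we have $P(2^t-1)>2^{\gamma t}$. Then there is a fixed integer $k$ such that for every $\eta>0$ there exists a family of $k$ query locally decodable codes of length $\exp(n^\eta)$; that is, there are constants $c>0$, $\delta>0$, $\epsilon<1/2$ such that for every $n\ge1$ there is a binary code $C_n:\{0,1\}^n\to\{0,1\}^{N_n}$ with $N_n\le e^{c\,n^{\eta}}$ which is $(k,\delta,\epsilon)$-locally decodable.
   Context: $P(m)$ denotes the largest prime factor of the integer $m$. For binary strings, $d_H$ is Hamming distance. A binary code $C:\{0,1\}^n\to\{0,1\}^N$ is $(k,\delta,\epsilon)$-locally decodable if there is a randomized algorithm $\mathcal A$ which, given an index $i\in[n]$ and oracle access to a string $y\in\{0,1\}^N$, makes at most $k$ queries to $y$, and satisfies $\Pr[\mathcal A^y(i)=x_i]\ge 1-\epsilon$ for all $x\in\{0,1\}^n$, all $i\in[n]$ and all $y\in\{0,1\}^N$ with $d_H(C(x),y)\le \delta N$ (probability over the coin tosses of $\mathcal A$). The notation $\exp(x)$ means $e^{O(x)}$. *)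

theory Defs
  imports
    "HOL-Probability.Probability_Mass_Function"
    "HOL-Computational_Algebra.Primes"
begin

text \<open>The value \<open>1\<close> in the degenerate cases \<open>m = 0\<close> and \<open>m = 1\<close> is a convention.\<close>

definition largest_prime_factor :: "nat \<Rightarrow> nat" where
  "largest_prime_factor m = (if m \<le> 1 then 1 else Max (prime_factors m))"

definition binary_strings :: "nat \<Rightarrow> bool list set" where
  "binary_strings n = {x. length x = n}"

definition hamming_dist :: "'a list \<Rightarrow> 'a list \<Rightarrow> nat" where
  "hamming_dist x y = card {j. j < length x \<and> x ! j \<noteq> y ! j}"

text \<open>
  A deterministic oracle algorithm with one output bit, as an adaptive decision tree:
  \<open>Query j l r\<close> reads position \<open>j\<close> of the oracle string and continues with \<open>l\<close> if the
  answer is \<open>False\<close> and with \<open>r\<close> if it is \<open>True\<close>.  Once the coin tosses are fixed, a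
  randomized oracle algorithm is such a tree, so a randomized algorithm is a
  probability distribution on trees.
\<close>

datatype oracle_alg = Output bool | Query nat oracle_alg oracle_alg

primrec run :: "oracle_alg \<Rightarrow> bool list \<Rightarrow> bool" where
  "run (Output b) y = b"
| "run (Query j l r) y = (if y ! j then run r y else run l y)"

primrec queries :: "oracle_alg \<Rightarrow> bool list \<Rightarrow> nat list" where
  "queries (Output b) y = []"
| "queries (Query j l r) y = j # (if y ! j then queries r y else queries l y)"

text \<open>Message indices and code word positions are counted from \<open>0\<close>.\<close>

definition locally_decodable ::
    "nat \<Rightarrow> real \<Rightarrow> real \<Rightarrow> nat \<Rightarrow> nat \<Rightarrow> (bool list \<Rightarrow> bool list) \<Rightarrow> bool" where
  "locally_decodable k \<delta> \<epsilon> n N C \<longleftrightarrow>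
     (\<exists>A :: nat \<Rightarrow> oracle_alg pmf.
        (\<forall>i<n. \<forall>T\<in>set_pmf (A i). \<forall>y\<in>binary_strings N.
            length (queries T y) \<le> k \<and> set (queries T y) \<subseteq> {..<N}) \<and>
        (\<forall>x\<in>binary_strings n. \<forall>i<n. \<forall>y\<in>binary_strings N.
            real (hamming_dist (C x) y) \<le> \<delta> * real N \<longrightarrow>
            measure_pmf.prob (A i) {T. run T y = x ! i} \<ge> 1 - \<epsilon>))"

end

theory Submission
  imports
    Defs
    "HOL-Algebra.Algebraic_Closure_Type"
    "HOL-Number_Theory.Residue_Primitive_Roots"
begin

text \<open>
  Let \<open>p\<close> be a large prime factor of \<open>2\<^sup>t - 1\<close> and \<open>G\<close> the group of \<open>p\<close>-th roots of unity in
  characteristic 2.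

  A bounded odd number of elements of \<open>G\<close> sums to zero.  If \<open>A\<close> is an \<open>m\<close>-fold sumset of \<open>G\<close>,
  consider the quotients \<open>Q = (A + A) / (A + A)\<close>.  Either \<open>Q\<close> contains the field \<open>K\<close> spanned by
  \<open>G\<close>, and a dilate sum \<open>A + \<xi>A\<close> with \<open>\<xi> \<in> Q\<close> is large on average over \<open>\<xi> \<in> K\<close>; or, \<open>Q\<close> being
  invariant under \<open>G\<close>, some \<open>\<xi> \<in> Q\<close> has \<open>\<xi> + 1 \<notin> Q\<close>, and then \<open>A + (\<xi> + 1)A\<close> has \<open>|A|\<^sup>2\<close> elements.
  Clearing denominators, the \<open>6m\<^sup>2\<close>-fold sumset has about \<open>min (|A|\<^sup>2, |K|)\<close> elements.  Because
  \<open>|G| > |K|\<^sup>\<gamma>\<close>, boundedly many such steps yield a sumset of more than \<open>|K| / 2\<close> elements, so that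
  \<open>1\<close> is a sum of a bounded even number of elements of \<open>G\<close>.

  Such a relation \<open>z\<^bsup>a 1\<^esup> + \<dots> + z\<^bsup>a k\<^esup> = 0\<close> is invariant under the Frobenius map, so the sum of the
  \<open>z\<^bsup>g a l\<^esup>\<close> vanishes for every \<open>g\<close> in the subgroup generated by 2 modulo \<open>p\<close>, while it is 1 for
  \<open>g = 0\<close>.  With vectors whose pairwise inner products lie in this subgroup and whose norms vanish
  modulo \<open>p\<close>, the code word entry \<open>\<Sum>j. x j z\<^bsup>\<langle>u j, v\<rangle>\<^esup>\<close> is decoded from the \<open>k\<close> points \<open>v + a l u i\<close>.
  Tensor powers of 0/1 vectors provide \<open>n\<close> such vectors in dimension \<open>O(n\<^bsup>1/d\<^esup>)\<close>, where \<open>d > \<gamma>t\<close> is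
  the order of 2 modulo \<open>p\<close>.
\<close>

hide_const (open) Divisibility.prime

subsection \<open>Growth of sumsets of a multiplicative group\<close>

primrec sums_of :: "'a::semiring_1 set \<Rightarrow> nat \<Rightarrow> 'a set" where
  "sums_of G 0 = {0}"
| "sums_of G (Suc n) = {x + g | x g. x \<in> sums_of G n \<and> g \<in> G}"

lemma sums_of_add:
  "x \<in> sums_of G m \<Longrightarrow> y \<in> sums_of G n \<Longrightarrow> x + y \<in> sums_of G (m + n)"
proof (induction n arbitrary: y)
  case (Suc n)
  then obtain y' g where y: "y = y' + g" "y' \<in> sums_of G n" "g \<in> G" by auto
  then have "x + y = (x + y') + g" "x + y' \<in> sums_of G (m + n)"
    using Suc by (auto simp: add.assoc)
  then show ?case using y(3) by auto
qed simp

lemma sums_of_1: "g \<in> G \<Longrightarrow> g \<in> sums_of G 1"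
  by simp

lemma sums_of_scale:
  assumes "\<And>g h. g \<in> G \<Longrightarrow> h \<in> G \<Longrightarrow> g * h \<in> G"
  shows "x \<in> sums_of G m \<Longrightarrow> g \<in> G \<Longrightarrow> x * g \<in> sums_of G m"
proof (induction m arbitrary: x)
  case (Suc m)
  then obtain y h where "x = y + h" "y \<in> sums_of G m" "h \<in> G" by auto
  then have "x * g = y * g + h * g" "y * g \<in> sums_of G m" "h * g \<in> G"
    using Suc assms by (auto simp: distrib_right)
  then show ?case by auto
qed simp

lemma sums_of_mult:
  assumes "\<And>g h. g \<in> G \<Longrightarrow> h \<in> G \<Longrightarrow> g * h \<in> G"
  shows "x \<in> sums_of G m \<Longrightarrow> y \<in> sums_of G n \<Longrightarrow> x * y \<in> sums_of G (m * n)"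
proof (induction n arbitrary: y)
  case (Suc n)
  then obtain z g where "y = z + g" "z \<in> sums_of G n" "g \<in> G" by auto
  then have "x * y = x * g + x * z" "x * g \<in> sums_of G m" "x * z \<in> sums_of G (m * n)"
    using Suc sums_of_scale[OF assms, of x m g] by (auto simp: distrib_left add.commute)
  then show ?case by (simp add: sums_of_add del: sums_of.simps)
qed simp

lemma sums_of_imp_sum:
  "x \<in> sums_of (range f) n \<Longrightarrow> \<exists>a::nat \<Rightarrow> 'b. x = (\<Sum>l<n. f (a l))"
proof (induction n arbitrary: x)
  case (Suc n)
  then obtain y b where "x = y + f b" "y \<in> sums_of (range f) n" by auto
  with Suc.IH obtain a :: "nat \<Rightarrow> 'b" where "x = (\<Sum>l<n. f (a l)) + f b" by metis
  then have "x = (\<Sum>l<Suc n. f ((a(n := b)) l))" by simp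
  then show ?case by blast
qed simp

text \<open>Cauchy-Schwarz over the fibres of \<open>f\<close>: their sizes add up to
  \<open>card S\<close>, and their squares add up to the number of collisions. Few collisions
  therefore force a large image.\<close>

lemma card_squared_le_image_collisions:
  assumes "finite S"
  shows "(card S)\<^sup>2 \<le> card (f ` S) * card {(x, y). x \<in> S \<and> y \<in> S \<and> f x = f y}"
proof -
  define F where "F z = {x \<in> S. f x = z}" for z
  have fin: "finite (F z)" for z using assms by (simp add: F_def)
  have "card (\<Union>z\<in>f ` S. F z) = (\<Sum>z\<in>f ` S. card (F z))"
    by (rule card_UN_disjoint) (use assms fin in \<open>auto simp: F_def\<close>)
  moreover have "(\<Union>z\<in>f ` S. F z) = S" by (auto simp: F_def)
  ultimately have 1: "card S = (\<Sum>z\<in>f ` S. card (F z))" by simp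
  have "{(x, y). x \<in> S \<and> y \<in> S \<and> f x = f y} = (\<Union>z\<in>f ` S. F z \<times> F z)"
    by (auto simp: F_def)
  also have "card \<dots> = (\<Sum>z\<in>f ` S. card (F z \<times> F z))"
    by (rule card_UN_disjoint) (use assms fin in \<open>auto simp: F_def\<close>)
  finally have 2: "card {(x, y). x \<in> S \<and> y \<in> S \<and> f x = f y} = (\<Sum>z\<in>f ` S. (card (F z))\<^sup>2)"
    by (simp add: card_cartesian_product power2_eq_square)
  have "(\<Sum>z\<in>f ` S. real (card (F z)))\<^sup>2 \<le> (\<Sum>z\<in>f ` S. (real (card (F z)))\<^sup>2) * card (f ` S)"
    by (rule sum_squared_le_sum_of_squares)
  then have "real ((card S)\<^sup>2) \<le> real (card (f ` S) * card {(x, y). x \<in> S \<and> y \<in> S \<and> f x = f y})"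
    unfolding 1 2 by (simp add: mult.commute)
  then show ?thesis by (simp only: of_nat_le_iff)
qed

text \<open>Two distinct pairs from \<open>A \<times> A\<close> collide for at most one \<xi>, so
  over all of \<open>K\<close> there are at most |A|^4 nontrivial collisions. Some \<xi> has no more
  than the average number, and Cauchy-Schwarz turns this into a lower bound for the dilate sum, of
  order min(|A|^2, |K|).\<close>

lemma exists_large_dilate_sum:
  fixes A K :: "'a::field set"
  assumes "finite A" "A \<noteq> {}" "finite K" "K \<noteq> {}"
  shows "\<exists>\<xi>\<in>K. card K * (card A)\<^sup>2
           \<le> card ((\<lambda>(a, b). a + \<xi> * b) ` (A \<times> A)) * (card K + (card A)\<^sup>2)"
proof -
  define f where "f \<xi> = (\<lambda>(a, b). a + \<xi> * b :: 'a)" for \<xi>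
  define E where "E \<xi> = {(s, t). s \<in> A \<times> A \<and> t \<in> A \<times> A \<and> f \<xi> s = f \<xi> t}" for \<xi>
  define E' where "E' \<xi> = {(s, t). s \<in> A \<times> A \<and> t \<in> A \<times> A \<and> f \<xi> s = f \<xi> t \<and> s \<noteq> t}" for \<xi>
  define \<alpha> where "\<alpha> = card A"
  have \<alpha>: "\<alpha> > 0" using assms by (simp add: \<alpha>_def card_gt_0_iff)
  have sub: "E' \<xi> \<subseteq> (A \<times> A) \<times> (A \<times> A)" for \<xi> by (auto simp: E'_def)
  have fin': "finite (E' \<xi>)" for \<xi>
    by (rule finite_subset[OF sub]) (use assms(1) in auto)
  have "E \<xi> = E' \<xi> \<union> (\<lambda>s. (s, s)) ` (A \<times> A)" for \<xi>
    by (auto simp: E_def E'_def)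
  then have cE: "card (E \<xi>) \<le> card (E' \<xi>) + \<alpha>\<^sup>2" for \<xi>
    using card_Un_le[of "E' \<xi>" "(\<lambda>s. (s, s)) ` (A \<times> A)"]
      card_image_le[of "A \<times> A" "\<lambda>s. (s, s)"] assms(1)
    by (simp add: card_cartesian_product \<alpha>_def power2_eq_square)
  have disj: "\<forall>\<xi>\<in>K. \<forall>\<eta>\<in>K. \<xi> \<noteq> \<eta> \<longrightarrow> E' \<xi> \<inter> E' \<eta> = {}"
  proof (intro ballI impI equals0I)
    fix \<xi> \<eta> p assume *: "\<xi> \<noteq> \<eta>" "p \<in> E' \<xi> \<inter> E' \<eta>"
    obtain a b c d where p: "p = ((a, b), (c, d))" by (metis surj_pair)
    have 1: "a + \<xi> * b = c + \<xi> * d" "a + \<eta> * b = c + \<eta> * d" "(a, b) \<noteq> (c, d)"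
      using *(2) by (auto simp: p E'_def f_def)
    \<comment> \<open>Subtracting the two collision equations forces b = d, and then a = c.\<close>
    have "(\<xi> - \<eta>) * (b - d) = (a + \<xi> * b) - (a + \<eta> * b) - ((c + \<xi> * d) - (c + \<eta> * d))"
      by (simp add: algebra_simps)
    also have "\<dots> = 0" using 1 by simp
    finally show False using * 1 by auto
  qed
  have "(\<Sum>\<xi>\<in>K. card (E' \<xi>)) = card (\<Union>\<xi>\<in>K. E' \<xi>)"
    using card_UN_disjoint[OF assms(3) _ disj] fin' by simp
  also have "\<dots> \<le> card ((A \<times> A) \<times> (A \<times> A))"
    using sub assms(1) by (intro card_mono) auto
  also have "\<dots> = \<alpha>^4" by (simp add: card_cartesian_product \<alpha>_def power4_eq_xxxx)
  finally have total: "(\<Sum>\<xi>\<in>K. card (E \<xi>)) \<le> \<alpha>^4 + card K * \<alpha>\<^sup>2"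
    using sum_mono[of K "\<lambda>\<xi>. card (E \<xi>)", OF cE] by (simp add: sum.distrib)
  have "\<exists>\<xi>\<in>K. card K * card (E \<xi>) \<le> \<alpha>^4 + card K * \<alpha>\<^sup>2"
  proof (rule ccontr)
    assume "\<not> ?thesis"
    then have "(\<Sum>\<xi>\<in>K. \<alpha>^4 + card K * \<alpha>\<^sup>2) < (\<Sum>\<xi>\<in>K. card K * card (E \<xi>))"
      using assms by (intro sum_strict_mono) auto
    then have "card K * (\<alpha>^4 + card K * \<alpha>\<^sup>2) < card K * (\<Sum>\<xi>\<in>K. card (E \<xi>))"
      by (simp add: sum_distrib_left)
    then show False using total by (metis mult_less_cancel1 not_less)
  qed
  then obtain \<xi> where \<xi>: "\<xi> \<in> K" "card K * card (E \<xi>) \<le> \<alpha>^4 + card K * \<alpha>\<^sup>2" by blast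
  define I where "I = card (f \<xi> ` (A \<times> A))"
  have "(\<alpha>\<^sup>2)\<^sup>2 \<le> I * card (E \<xi>)"
    using card_squared_le_image_collisions[of "A \<times> A" "f \<xi>"] assms(1)
    by (simp add: card_cartesian_product \<alpha>_def power2_eq_square E_def I_def)
  then have "card K * (\<alpha>\<^sup>2)\<^sup>2 \<le> I * (card K * card (E \<xi>))"
    by (metis mult.left_commute mult_le_mono2)
  also have "\<dots> \<le> I * (\<alpha>^4 + card K * \<alpha>\<^sup>2)" using \<xi>(2) by simp
  finally have "(card K * \<alpha>\<^sup>2) * \<alpha>\<^sup>2 \<le> (I * (card K + \<alpha>\<^sup>2)) * \<alpha>\<^sup>2"
    by (simp add: algebra_simps power2_eq_square power4_eq_xxxx)
  then have "card K * \<alpha>\<^sup>2 \<le> I * (card K + \<alpha>\<^sup>2)" using \<alpha> by simp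
  then show ?thesis using \<xi>(1) by (auto simp: I_def f_def \<alpha>_def)
qed

text \<open>The number of summands after \<open>j\<close> rounds of growth; one round passes from
  \<open>m\<close> to \<open>6 * m\<^sup>2\<close> summands, as in
  \<open>card_sums_of_growth\<close>.\<close>

primrec growth_steps :: "nat \<Rightarrow> nat" where
  "growth_steps 0 = 1"
| "growth_steps (Suc j) = 6 * (growth_steps j)\<^sup>2"

lemma growth_steps_mono: "i \<le> j \<Longrightarrow> growth_steps i \<le> growth_steps j"
proof (induction j)
  case (Suc j)
  have "growth_steps j \<le> growth_steps (Suc j)"
    by (simp add: power2_eq_square)
  then show ?case using Suc by (cases "i = Suc j") auto
qed simp

section \<open>Sumset growth for a multiplicative group in characteristic 2\<close>

context
  fixes G :: "'a::field set" and K :: "'a set"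
  assumes char2: "\<And>x::'a. x + x = 0"
    and one: "1 \<in> G"
    and zero: "0 \<notin> G"
    and mult: "\<And>g h. g \<in> G \<Longrightarrow> h \<in> G \<Longrightarrow> g * h \<in> G"
    and inv: "\<And>g. g \<in> G \<Longrightarrow> inverse g \<in> G"
    and K_def: "K = (\<Union>n. sums_of G n)"
    and fin: "finite K"
begin

lemma sums_of_sub: "sums_of G n \<subseteq> K"
  by (auto simp: K_def)

lemma finite_sums_of: "finite (sums_of G n)"
  using sums_of_sub fin finite_subset by blast

lemma sums_of_ne: "sums_of G n \<noteq> {}"
proof (induction n)
  case (Suc n)
  then show ?case using one by auto
qed simp

lemma minus_eq: "- x = (x::'a)"
  using char2[of x] by (simp add: eq_neg_iff_add_eq_0)

lemma diff_eq: "x - y = x + (y::'a)"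
  by (metis minus_eq diff_conv_add_uminus)

text \<open>Since 1 + 1 = 0, a sum can be padded by pairs of ones. Padding keeps the parity of the
  number of summands, which is what makes an odd zero sum informative.\<close>

lemma sums_of_parity_mono:
  assumes "x \<in> sums_of G m"
  shows "x \<in> sums_of G (m + 2 * n)"
proof (induction n)
  case (Suc n)
  have "(x + 1) + 1 = x" using char2[of 1] by (simp add: add.assoc)
  moreover have "(x + 1) + 1 \<in> sums_of G (m + 2 * n + 1 + 1)"
    by (intro sums_of_add sums_of_1 Suc one)
  moreover have "m + 2 * n + 1 + 1 = m + 2 * Suc n" by simp
  ultimately show ?case by metis
qed (use assms in simp)

text \<open>Multiplication by \<open>v\<close> is injective and clears the denominator of the slope
  \<open>u / v\<close>, which embeds the dilate sum in a sumset of \<open>G\<close>.\<close>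

lemma card_dilate_sum_le:
  assumes v: "v \<noteq> 0" and B: "\<And>a b. a \<in> A \<Longrightarrow> b \<in> A \<Longrightarrow> v * a + u * b \<in> sums_of G n"
  shows "card ((\<lambda>(a, b). a + (u / v) * b) ` (A \<times> A)) \<le> card (sums_of G n)"
proof (rule card_inj_on_le)
  show "inj_on ((*) v) ((\<lambda>(a, b). a + (u / v) * b) ` (A \<times> A))"
    using v by (auto simp: inj_on_def)
  show "(*) v ` ((\<lambda>(a, b). a + (u / v) * b) ` (A \<times> A)) \<subseteq> sums_of G n"
    using v B by (auto simp: distrib_left)
qed (rule finite_sums_of)

text \<open>If the slope set \<open>Q\<close> contains \<open>K\<close>, averaging over
  \<open>K\<close> supplies a good slope; otherwise a slope outside \<open>Q\<close> gives an
  injective dilate sum. The factor 6 counts products of two elements of \<open>A\<close> after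
  clearing denominators: the slope \<xi> + 1 has numerator a + b + c + d and denominator c +
  d.\<close>

lemma card_sums_of_growth:
  "card K * (card (sums_of G m))\<^sup>2
     \<le> card (sums_of G (6 * m\<^sup>2)) * (card K + (card (sums_of G m))\<^sup>2)"
proof -
  define A where "A = sums_of G m"
  \<comment> \<open>Sums are differences in characteristic 2, so \<open>Q\<close> consists of the
    \<xi> for which (s, t) \<mapsto> s + \<xi> t fails to be injective on
    \<open>A \<times> A\<close>.\<close>
  define Q where "Q = {(a + b) / (c + d) | a b c d. a \<in> A \<and> b \<in> A \<and> c \<in> A \<and> d \<in> A \<and> c \<noteq> d}"
  have ne: "c + d \<noteq> 0" if "c \<noteq> d" for c d :: 'a
    using that by (metis diff_eq eq_iff_diff_eq_0)
  have finA: "finite A" "A \<noteq> {}" unfolding A_def by (rule finite_sums_of sums_of_ne)+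
  have AA: "a * b \<in> sums_of G (m\<^sup>2)" if "a \<in> A" "b \<in> A" for a b
    using sums_of_mult[OF mult] that by (auto simp: A_def power2_eq_square)
  consider "card A = 1" | "card A \<noteq> 1" "K \<subseteq> Q" | "card A \<noteq> 1" "\<not> K \<subseteq> Q" by blast
  then show ?thesis
  proof cases
    \<comment> \<open>Here \<open>Q\<close> is empty, so the dichotomy below would have no starting
      point 0 in \<open>Q\<close>; the inequality itself is trivial.\<close>
    case 1
    have "card (sums_of G (6 * m\<^sup>2)) \<ge> 1"
      using finite_sums_of sums_of_ne by (simp add: Suc_le_eq card_gt_0_iff)
    then have "1 * (card K + (card A)\<^sup>2) \<le> card (sums_of G (6 * m\<^sup>2)) * (card K + (card A)\<^sup>2)"
      by (rule mult_le_mono1)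
    moreover have "card K * (card A)\<^sup>2 \<le> 1 * (card K + (card A)\<^sup>2)" using 1 by simp
    ultimately show ?thesis unfolding A_def by (rule order_trans[rotated])
  next
    case 2
    note True = this(2)
    have "K \<noteq> {}" using sums_of_sub[of 0] by auto
    then obtain \<xi> where \<xi>: "\<xi> \<in> K" "card K * (card A)\<^sup>2
           \<le> card ((\<lambda>(a, b). a + \<xi> * b) ` (A \<times> A)) * (card K + (card A)\<^sup>2)"
      using exists_large_dilate_sum[OF finA fin] by blast
    from \<xi>(1) True obtain a b c d where abcd: "\<xi> = (a + b) / (c + d)" "c \<noteq> d"
      "a \<in> A" "b \<in> A" "c \<in> A" "d \<in> A" by (auto simp: Q_def)
    have "card ((\<lambda>(a, b). a + \<xi> * b) ` (A \<times> A)) \<le> card (sums_of G (6 * m\<^sup>2))"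
      unfolding abcd(1)
    proof (rule card_dilate_sum_le)
      fix s t assume st: "s \<in> A" "t \<in> A"
      have "((c * s + d * s) + (a * t + b * t)) \<in> sums_of G ((m\<^sup>2 + m\<^sup>2) + (m\<^sup>2 + m\<^sup>2))"
        by (intro sums_of_add AA st abcd)
      moreover have "(m\<^sup>2 + m\<^sup>2) + (m\<^sup>2 + m\<^sup>2) = 4 * m\<^sup>2" by simp
      ultimately have "(c + d) * s + (a + b) * t \<in> sums_of G (4 * m\<^sup>2)"
        by (simp only: distrib_right)
      \<comment> \<open>This case produces only \<open>4 * m\<^sup>2\<close> summands;
        \<open>m\<^sup>2\<close> pairs of ones bring it to the common count.\<close>
      from sums_of_parity_mono[OF this, of "m\<^sup>2"]
      show "(c + d) * s + (a + b) * t \<in> sums_of G (6 * m\<^sup>2)" by simp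
    qed (use abcd ne in auto)
    then show ?thesis using \<xi>(2) unfolding A_def[symmetric]
      by (meson le_trans mult_le_mono1)
  next
    case 3
    note nontriv = this(1) and False = this(2)
    have scaleQ: "x * g \<in> Q" if "x \<in> Q" "g \<in> G" for x g
    proof -
      from that obtain a b c d where abcd: "x = (a + b) / (c + d)" "c \<noteq> d"
        "a \<in> A" "b \<in> A" "c \<in> A" "d \<in> A" by (auto simp: Q_def)
      have eq: "x * g = (a * g + b * g) / (c + d)" by (simp add: abcd distrib_right)
      have mem: "a * g \<in> A" "b * g \<in> A"
        using sums_of_scale[OF mult] abcd that by (auto simp: A_def)
      show ?thesis unfolding Q_def
        by (rule CollectI, rule exI[of _ "a * g"], rule exI[of _ "b * g"], rule exI[of _ c], rule exI[of _ d])
          (intro conjI eq mem abcd)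
    qed
    \<comment> \<open>Were \<open>Q\<close> closed under adding 1, invariance under \<open>G\<close>
      would make it closed under adding any g, by x + g = (x / g + 1) g. As it contains 0, it would
      then contain all of \<open>K\<close>.\<close>
    have "\<exists>\<xi>\<in>Q. \<xi> + 1 \<notin> Q"
    proof (rule ccontr)
      assume *: "\<not> ?thesis"
      have "sums_of G n \<subseteq> Q" for n
      proof (induction n)
        case 0
        have "A \<noteq> {c}" for c using nontriv by auto
        then obtain c d where "c \<in> A" "d \<in> A" "c \<noteq> d" using finA by blast
        moreover have "0 = (c + c) / (c + d)" by (simp only: char2 div_0)
        ultimately have "0 \<in> Q" unfolding Q_def by blast
        then show ?case by simp
      next
        case (Suc n)
        show ?case
        proof
          fix y assume "y \<in> sums_of G (Suc n)"
          then obtain x g where y: "y = x + g" "x \<in> sums_of G n" "g \<in> G" by auto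
          have g: "g \<noteq> 0" using zero y by auto
          have "x * inverse g \<in> Q" using Suc y inv scaleQ by auto
          then have "(x * inverse g + 1) * g \<in> Q" using * scaleQ y by blast
          moreover have "(x * inverse g + 1) * g = y" using g y by (simp add: field_simps)
          ultimately show "y \<in> Q" by simp
        qed
      qed
      then show False using False by (auto simp: K_def)
    qed
    then obtain \<xi> where \<xi>: "\<xi> \<in> Q" "\<xi> + 1 \<notin> Q" by blast
    from \<xi>(1) obtain a b c d where abcd: "\<xi> = (a + b) / (c + d)" "c \<noteq> d"
      "a \<in> A" "b \<in> A" "c \<in> A" "d \<in> A" by (auto simp: Q_def)
    have \<xi>1: "\<xi> + 1 = (a + b + c + d) / (c + d)"
      using ne[OF abcd(2)] by (simp add: abcd(1) field_simps)
    have "inj_on (\<lambda>(s, t). s + (\<xi> + 1) * t) (A \<times> A)"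
    proof (rule inj_onI, clarify)
      fix s t s' t' assume *: "s \<in> A" "t \<in> A" "s' \<in> A" "t' \<in> A" "s + (\<xi> + 1) * t = s' + (\<xi> + 1) * t'"
      have "s - s' = (\<xi> + 1) * (t' - t)" using *(5) by (simp add: algebra_simps)
      then have eq: "s + s' = (\<xi> + 1) * (t' + t)" by (simp add: diff_eq)
      have "t' = t"
      proof (rule ccontr)
        assume t: "t' \<noteq> t"
        then have "\<xi> + 1 = (s + s') / (t' + t)" using eq ne by simp
        then show False using \<xi>(2) t * by (auto simp: Q_def)
      qed
      then show "s = s' \<and> t = t'" using * by simp
    qed
    then have "(card A)\<^sup>2 = card ((\<lambda>(s, t). s + (\<xi> + 1) * t) ` (A \<times> A))"
      by (simp add: card_image card_cartesian_product power2_eq_square)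
    also have "\<dots> \<le> card (sums_of G (6 * m\<^sup>2))"
      unfolding \<xi>1
    proof (rule card_dilate_sum_le)
      fix s t assume st: "s \<in> A" "t \<in> A"
      have "((c * s + d * s) + (a * t + b * t + (c * t + d * t)))
          \<in> sums_of G ((m\<^sup>2 + m\<^sup>2) + (m\<^sup>2 + m\<^sup>2 + (m\<^sup>2 + m\<^sup>2)))"
        by (intro sums_of_add AA st abcd)
      moreover have "(m\<^sup>2 + m\<^sup>2) + (m\<^sup>2 + m\<^sup>2 + (m\<^sup>2 + m\<^sup>2)) = 6 * m\<^sup>2" by simp
      ultimately show "(c + d) * s + (a + b + c + d) * t \<in> sums_of G (6 * m\<^sup>2)"
        by (simp only: distrib_right add.assoc)
    qed (use abcd ne in auto)
    finally show ?thesis unfolding A_def[symmetric]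
      by (metis add.commute mult.commute mult_le_mono le_add2)
  qed
qed

text \<open>Growth makes \<open>B\<close> larger than half of \<open>K\<close>, so \<open>B\<close>
  and its translate 1 + B, both inside \<open>K\<close>, must meet. From x = 1 + y with x, y in
  \<open>B\<close> follows 1 = x + y.\<close>

lemma one_in_sums_of:
  assumes "card K < (card (sums_of G m))\<^sup>2"
  shows "1 \<in> sums_of G (12 * m\<^sup>2)"
proof -
  define B where "B = sums_of G (6 * m\<^sup>2)"
  define \<alpha> where "\<alpha> = card (sums_of G m)"
  have B: "B \<subseteq> K" "finite B" "card B > 0"
    using sums_of_sub finite_sums_of sums_of_ne by (auto simp: B_def card_gt_0_iff)
  have "card K * \<alpha>\<^sup>2 \<le> card B * (card K + \<alpha>\<^sup>2)"
    using card_sums_of_growth by (simp add: B_def \<alpha>_def)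
  also have "\<dots> < card B * (\<alpha>\<^sup>2 + \<alpha>\<^sup>2)"
    using assms B(3) by (intro mult_strict_left_mono) (auto simp: \<alpha>_def)
  also have "\<dots> = (2 * card B) * \<alpha>\<^sup>2" by simp
  finally have "card K * \<alpha>\<^sup>2 < (2 * card B) * \<alpha>\<^sup>2" .
  then have large: "card K < 2 * card B" using mult_less_cancel2 by blast
  have "(+) 1 ` B \<subseteq> K"
  proof clarify
    fix x assume "x \<in> B"
    then have "x + 1 \<in> sums_of G (6 * m\<^sup>2 + 1)"
      unfolding B_def by (intro sums_of_add sums_of_1 one)
    then show "1 + x \<in> K" using sums_of_sub by (metis add.commute subsetD)
  qed
  then have "card (B \<union> (+) 1 ` B) \<le> card K"
    using B fin by (intro card_mono) auto
  moreover have "card ((+) 1 ` B) = card B" by (simp add: card_image)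
  ultimately have "B \<inter> (+) 1 ` B \<noteq> {}"
    using large card_Un_disjoint[of B "(+) 1 ` B"] B(2) by (auto simp: mult_2)
  then obtain x y where "x \<in> B" "y \<in> B" "x = 1 + y" by auto
  then have "1 \<in> sums_of G (6 * m\<^sup>2 + 6 * m\<^sup>2)"
    unfolding B_def using sums_of_add[of x G "6 * m\<^sup>2" y] char2[of y] by (simp only: add.assoc add_0_right)
  then show ?thesis by simp
qed

text \<open>As long as the square of the sumset size is at most |K|, a round of growth at least
  squares half the size. This cannot last for \<open>3 * s\<close> rounds, so 1 becomes an even sum,
  and one more summand 1 gives an odd zero sum. Its length depends on \<open>s\<close>
  alone.\<close>

lemma zero_in_odd_sums_of:
  assumes "card G \<ge> 3" and "card K \<le> card G ^ s"
  shows "0 \<in> sums_of G (12 * (growth_steps (3 * s))\<^sup>2 + 1)"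
proof -
  define J where "J = 3 * s"
  define p where "p = real (card G)"
  define a where "a i = real (card (sums_of G (growth_steps i)))" for i
  have p: "p \<ge> 3" using assms by (simp add: p_def)
  have Kpos: "real (card K) > 0"
    using sums_of_sub[of 0] fin by (auto simp: card_gt_0_iff)
  have "\<exists>i\<le>J. card K < (card (sums_of G (growth_steps i)))\<^sup>2"
  proof (rule ccontr)
    assume "\<not> ?thesis"
    then have small: "(card (sums_of G (growth_steps i)))\<^sup>2 \<le> card K" if "i \<le> J" for i
      using that not_less by blast
    have small: "(a i)\<^sup>2 \<le> card K" if "i \<le> J" for i
      using small[OF that] unfolding a_def by (metis of_nat_le_iff of_nat_power)
    \<comment> \<open>Halving turns the recursion \<open>(a i)\<^sup>2 \<le> 2 * a (Suc i)\<close>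
      into plain squaring; since p \<ge> 3, the start p / 2 exceeds 1.\<close>
    have "i \<le> J \<Longrightarrow> (p / 2) ^ (2 ^ i) \<le> a i / 2" for i
    proof (induction i)
      case 0
      have "sums_of G 1 = G" by auto
      then show ?case by (simp add: a_def p_def)
    next
      case (Suc i)
      have "card K * (a i)\<^sup>2 \<le> a (Suc i) * (card K + (a i)\<^sup>2)"
        using card_sums_of_growth[of "growth_steps i"]
        unfolding a_def growth_steps.simps
        by (simp flip: of_nat_power of_nat_mult of_nat_add)
      also have "\<dots> \<le> a (Suc i) * (card K + card K)"
        using small[of i] Suc.prems by (intro mult_left_mono) (auto simp: a_def)
      finally have "card K * (a i)\<^sup>2 \<le> card K * (2 * a (Suc i))" by (simp add: algebra_simps)
      then have "(a i)\<^sup>2 \<le> 2 * a (Suc i)" using Kpos by (simp only: mult_le_cancel_left_pos)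
      moreover have "((p / 2) ^ (2 ^ i))\<^sup>2 \<le> (a i / 2)\<^sup>2"
        using Suc p by (intro power_mono) auto
      moreover have "(p / 2) ^ (2 ^ Suc i) = ((p / 2) ^ (2 ^ i))\<^sup>2"
        by (simp only: power_Suc power_even_eq)
      ultimately show ?case by (simp add: power_divide)
    qed
    from this[of J] have "(p / 2) ^ (2 ^ J) \<le> a J / 2" by simp
    moreover have "p ^ s \<le> (p / 2) ^ (2 ^ J)"
    proof -
      \<comment> \<open>This gives p \<le> (p / 2)^3, the source of the factor 3 in
        \<open>J\<close>.\<close>
      have "p * 8 \<le> p * p\<^sup>2"
        using p power_mono[of 3 p 2] by (intro mult_left_mono) auto
      then have "p \<le> (p / 2) ^ 3" by (simp add: power_divide power3_eq_cube power2_eq_square)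
      then have "p ^ s \<le> ((p / 2) ^ 3) ^ s" using p by (intro power_mono) auto
      also have "\<dots> = (p / 2) ^ J" by (simp add: J_def power_mult)
      also have "\<dots> \<le> (p / 2) ^ (2 ^ J)"
        using p by (intro power_increasing) (auto intro: less_imp_le)
      finally show ?thesis .
    qed
    moreover have "a J \<le> p ^ s"
    proof -
      have "card (sums_of G (growth_steps J)) \<le> card G ^ s"
        using card_mono[OF fin sums_of_sub] assms(2) le_trans by blast
      then show ?thesis unfolding a_def p_def by (metis of_nat_le_iff of_nat_power)
    qed
    moreover have "p ^ s > 0" using p by simp
    ultimately show False by linarith
  qed
  then obtain i where i: "i \<le> J" "1 \<in> sums_of G (12 * (growth_steps i)\<^sup>2)"
    using one_in_sums_of by blast
  have "1 + 1 \<in> sums_of G (12 * (growth_steps i)\<^sup>2 + 1)"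
    by (intro sums_of_add sums_of_1 i one)
  then have "0 \<in> sums_of G (12 * (growth_steps i)\<^sup>2 + 1)" by (simp only: char2)
  \<comment> \<open>The successful round \<open>i\<close> is not known in advance; padding brings
    every case to the length belonging to \<open>J\<close>.\<close>
  from sums_of_parity_mono[OF this, of "6 * ((growth_steps J)\<^sup>2 - (growth_steps i)\<^sup>2)"]
  have "0 \<in> sums_of G (12 * (growth_steps i)\<^sup>2 + 1
      + 2 * (6 * ((growth_steps J)\<^sup>2 - (growth_steps i)\<^sup>2)))" .
  moreover have "(growth_steps i)\<^sup>2 \<le> (growth_steps J)\<^sup>2"
    using growth_steps_mono[OF i(1)] by (rule power_mono) simp
  then have "12 * (growth_steps i)\<^sup>2 + 1 + 2 * (6 * ((growth_steps J)\<^sup>2 - (growth_steps i)\<^sup>2))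
      = 12 * (growth_steps J)\<^sup>2 + 1"
    by linarith
  ultimately show ?thesis by (simp only: J_def)
qed

end

subsection \<open>Odd zero sums of roots of unity\<close>

lemma CHAR_gf2: "CHAR(gf2) = 2"
proof (rule CHAR_eqI)
  have two: "(1::gf2) + 1 = 0" by transfer simp
  then show "of_nat 2 = (0::gf2)" by simp
  fix n assume n: "of_nat n = (0::gf2)"
  show "2 dvd n"
  proof (rule ccontr)
    assume "odd n"
    then obtain m where "n = 2 * m + 1" by (elim oddE)
    then have "of_nat n = (1 + 1) * of_nat m + (1::gf2)" by simp
    then show False using two n by simp
  qed
qed

lemma gf2_add_neq_0_iff: "(x + y \<noteq> (0::gf2)) \<longleftrightarrow> (x \<noteq> 0) \<noteq> (y \<noteq> 0)"
  by transfer auto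

text \<open>A linear functional over the two-element field with value 1 at 1. It turns field-valued
  code symbols into bits while addition becomes exclusive or.\<close>

lemma ex_parity_functional:
  "\<exists>L :: gf2 alg_closure \<Rightarrow> bool. L 1 \<and> (\<forall>x y. L (x + y) \<longleftrightarrow> L x \<noteq> L y)"
proof -
  define sc where "sc = (\<lambda>c (x::gf2 alg_closure). to_ac c * x)"
  interpret V: vector_space sc
    by unfold_locales (auto simp: sc_def algebra_simps)
  interpret W: vector_space "(*) :: gf2 \<Rightarrow> _"
    by unfold_locales (auto simp: algebra_simps)
  interpret VW: vector_space_pair sc "(*) :: gf2 \<Rightarrow> _" ..
  have "V.independent {1}"
    by (simp add: V.independent_insert)
  then obtain g where g: "Vector_Spaces.linear sc (*) g" "g 1 = 1"
    using VW.linear_independent_extend[of "{1}" "\<lambda>_. 1"] by auto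
  then interpret g: Vector_Spaces.linear sc "(*)" g by simp
  show ?thesis
    by (rule exI[of _ "\<lambda>x. g x \<noteq> 0"]) (simp add: g g.add gf2_add_neq_0_iff)
qed

text \<open>Take a root of 1 + X + ... + X^(p-1). It differs from 1 because the value at 1 is
  \<open>p\<close>, which is odd and hence nonzero in characteristic 2.\<close>

lemma ex_nontrivial_root_of_unity:
  assumes "odd p" "p > 1"
  shows "\<exists>z :: gf2 alg_closure. z \<noteq> 1 \<and> z ^ p = 1"
proof -
  obtain z :: "gf2 alg_closure" where z: "(\<Sum>k\<le>p - 1. 1 * z ^ k) = 0"
    using alg_closed[of "p - 1" "\<lambda>_. 1"] assms by auto
  have "{..p - 1} = {..<p}" using assms by auto
  with z have sum0: "(\<Sum>k<p. z ^ k) = 0" by simp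
  have "z \<noteq> 1"
  proof
    assume "z = 1"
    then have "of_nat p = (0 :: gf2 alg_closure)" using sum0 by simp
    then show False using assms by (simp add: of_nat_eq_0_iff_char_dvd CHAR_gf2)
  qed
  moreover have "z ^ p = 1"
    using power_diff_1_eq[of z p] sum0 by simp
  ultimately show ?thesis by blast
qed

text \<open>Otherwise Bezout would express \<open>z\<close> through \<open>z ^ p\<close> and
  \<open>z ^ d\<close>, forcing z = 1.\<close>

lemma root_of_unity_power_eq_1:
  fixes z :: "'a::field"
  assumes "prime p" "z \<noteq> 1" "z ^ p = 1" "z ^ d = 1"
  shows "p dvd d"
proof (rule ccontr)
  assume nd: "\<not> p dvd d"
  then have "coprime d p"
    using assms(1) prime_imp_coprime[of p d] coprime_commute by blast
  moreover have "d \<noteq> 0" using nd by (rule contrapos_nn) simp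
  ultimately obtain x y where "d * x = p * y + 1"
    using bezout_add_strong_nat[of d p] by (metis coprime_iff_gcd_eq_1 nat_dvd_1_iff_1 gcd_greatest)
  then have "(z ^ d) ^ x = (z ^ p) ^ y * z"
    by (metis power_add power_mult power_one_right)
  then show False using assms by simp
qed

lemma power_mod_root_of_unity:
  fixes z :: "'a::monoid_mult"
  assumes "z ^ p = 1"
  shows "z ^ (n mod p) = z ^ n"
  by (metis assms div_mult_mod_eq mult.commute mult_1 power_add power_mult power_one)

text \<open>Growth is applied to the group of powers of \<open>z\<close>. Its additive span lies
  among the roots of X^(2^t) - X, so it has at most \<open>2 ^ t \<le> p ^ s\<close> elements, while
  the group has at least \<open>p\<close>.\<close>

lemma ex_odd_zero_sum_of_roots:
  fixes z :: "'a::field"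
  assumes char: "CHAR('a) = 2" and p: "prime p" "p \<ge> 3" "p dvd 2 ^ t - 1" and t: "t > 0"
    and s: "2 ^ t \<le> p ^ s" and z: "z \<noteq> 1" "z ^ p = 1"
  shows "\<exists>a. (\<Sum>l < 12 * (growth_steps (3 * s))\<^sup>2 + 1. z ^ a l) = 0"
proof -
  define G where "G = range (\<lambda>i. z ^ i)"
  define K where "K = (\<Union>n. sums_of G n)"
  have z0: "z \<noteq> 0" using z p by (auto simp: power_0_left)
  have char2: "x + x = 0" for x :: 'a
    using of_nat_CHAR[where 'a = 'a] char by (simp flip: mult_2)
  have "z ^ (2 ^ t - 1) = 1"
    using p(3) z by (auto simp: power_mult)
  then have Frob_z: "z ^ (2 ^ t) = z"
    by (metis Suc_pred' mult.right_neutral pos2 power_Suc zero_less_power)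
  \<comment> \<open>The fixed points of an iterated Frobenius map are closed under addition.\<close>
  have Frob: "x ^ (2 ^ t) = x" if "x \<in> sums_of G n" for x n
    using that
  proof (induction n arbitrary: x)
    case (Suc n)
    then obtain y i where "x = y + z ^ i" "y ^ (2 ^ t) = y" by (auto simp: G_def)
    moreover have "(z ^ i) ^ (2 ^ t) = z ^ i"
      by (metis Frob_z power_mult mult.commute)
    ultimately show ?case
      using freshmans_dream'[of "2 ^ t" t y "z ^ i"] char by simp
  qed (simp add: power_0_left)
  define P :: "'a poly" where "P = Polynomial.monom 1 (2 ^ t) - Polynomial.monom 1 1"
  have t2: "(2::nat) ^ t \<ge> 2" using t by (cases t) auto
  have "Polynomial.coeff P (2 ^ t) = 1" using t2 by (simp add: P_def)
  then have P0: "P \<noteq> 0" by auto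
  have degP: "Polynomial.degree P \<le> 2 ^ t"
    unfolding P_def using t2 by (intro degree_diff_le) (auto intro: degree_monom_le order_trans[OF degree_monom_le])
  have sub: "K \<subseteq> {x. poly P x = 0}"
    using Frob by (auto simp: K_def P_def poly_monom)
  have finK: "finite K"
    using finite_subset[OF sub] poly_roots_finite[OF P0] by simp
  have cardK: "card K \<le> 2 ^ t"
    using card_mono[OF _ sub] poly_roots_finite[OF P0] card_poly_roots_bound[OF P0] degP by linarith
  have inj: "inj_on (\<lambda>i. z ^ i) {..<p}"
  proof (rule linorder_inj_onI)
    fix i j assume *: "i < j" "i \<in> {..<p}" "j \<in> {..<p}"
    show "z ^ i \<noteq> z ^ j"
    proof
      assume "z ^ i = z ^ j"
      also have "z ^ j = z ^ i * z ^ (j - i)" using * by (simp flip: power_add)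
      finally have "z ^ (j - i) = 1" using z0 by simp
      from root_of_unity_power_eq_1[OF p(1) z this] * show False
        by (auto dest: dvd_imp_le)
    qed
  qed auto
  have "G \<subseteq> sums_of G 1" by auto
  then have "G \<subseteq> K" unfolding K_def by blast
  then have "finite G" using finK finite_subset by blast
  then have cardG: "p \<le> card G"
    using card_mono[of G "(\<lambda>i. z ^ i) ` {..<p}"] card_image[OF inj] by (auto simp: G_def)
  have one: "1 \<in> G" unfolding G_def by (rule image_eqI[of _ _ 0]) auto
  have zero: "0 \<notin> G" using z0 by (auto simp: G_def)
  have mult: "g * h \<in> G" if "g \<in> G" "h \<in> G" for g h
    using that by (auto simp: G_def simp flip: power_add)
  have inv: "inverse g \<in> G" if "g \<in> G" for g
  proof -
    from that obtain i where g: "g = z ^ i" by (auto simp: G_def)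
    have "g * z ^ (i * (p - 1)) = (z ^ p) ^ i"
      using p by (simp add: g algebra_simps flip: power_add power_mult)
    then have "inverse g = z ^ (i * (p - 1))"
      using z by (simp add: inverse_unique)
    then show ?thesis by (simp add: G_def)
  qed
  have "card K \<le> card G ^ s"
    using cardK s power_mono[OF cardG, of s] by linarith
  moreover have "card G \<ge> 3" using p cardG by simp
  ultimately have "0 \<in> sums_of G (12 * (growth_steps (3 * s))\<^sup>2 + 1)"
    using zero_in_odd_sums_of[OF char2 one zero mult inv K_def finK] by blast
  then show ?thesis unfolding G_def by (metis sums_of_imp_sum)
qed

subsection \<open>Decoding by exclusive or\<close>

text \<open>Both branches continue with the same positions, so the decoder is nonadaptive;
  \<open>b\<close> accumulates the parity of the answers.\<close>

primrec xor_alg :: "nat list \<Rightarrow> bool \<Rightarrow> oracle_alg" where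
  "xor_alg [] b = Output b"
| "xor_alg (j # js) b = Query j (xor_alg js b) (xor_alg js (\<not> b))"

lemma queries_xor_alg [simp]: "queries (xor_alg js b) y = js"
  by (induction js arbitrary: b) auto

lemma run_xor_alg_functional:
  fixes L :: "'a::comm_monoid_add \<Rightarrow> bool"
  assumes L: "\<And>x y. L (x + y) \<longleftrightarrow> L x \<noteq> L y"
    and y: "\<And>j. j \<in> set js \<Longrightarrow> y ! j = L (v j)"
  shows "run (xor_alg js b) y \<longleftrightarrow> b \<noteq> L (\<Sum>j\<leftarrow>js. v j)"
  using y
proof (induction js arbitrary: b)
  case Nil
  have "\<not> L 0" using L[of 0 0] by simp
  then show ?case by simp
qed (auto simp: L)

text \<open>The decoder draws z uniformly from \<open>Y i\<close> and adds the bits at its k shifts.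
  By injectivity a corrupted position spoils at most one z for each \<open>l\<close>. With |Z| \<le>
  p |Y i|, the spoiled fraction is at most k p times the corruption rate, which explains the choice
  1 / (4 k p).\<close>

lemma locally_decodable_of_shifts:
  fixes Z :: "'z set" and f :: "nat \<Rightarrow> 'z \<Rightarrow> 'a::comm_ring_1"
    and shift :: "nat \<Rightarrow> nat \<Rightarrow> 'z \<Rightarrow> 'z" and L :: "'a \<Rightarrow> bool"
  assumes L: "\<And>x y. L (x + y) \<longleftrightarrow> L x \<noteq> L y" "L 1"
    and Z: "finite Z" and kp: "k > 0" "p > 0"
    and Y: "\<And>i. i < n \<Longrightarrow> Y i \<subseteq> Z" "\<And>i. i < n \<Longrightarrow> Y i \<noteq> {}"
      "\<And>i. i < n \<Longrightarrow> card Z \<le> p * card (Y i)"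
    and inj: "\<And>i l. i < n \<Longrightarrow> l < k \<Longrightarrow> inj_on (shift i l) (Y i)"
    and into: "\<And>i l z. i < n \<Longrightarrow> l < k \<Longrightarrow> z \<in> Y i \<Longrightarrow> shift i l z \<in> Z"
    and decode: "\<And>i j z. i < n \<Longrightarrow> j < n \<Longrightarrow> z \<in> Y i \<Longrightarrow>
      (\<Sum>l<k. f j (shift i l z)) = (if j = i then 1 else 0)"
  shows "\<exists>C \<in> binary_strings n \<rightarrow> binary_strings (card Z).
           locally_decodable k (1 / (4 * real k * real p)) (1 / 4) n (card Z) C"
proof -
  define N where "N = card Z"
  obtain \<phi> where \<phi>: "bij_betw \<phi> Z {..<N}"
    using ex_bij_betw_finite_nat[OF Z] by (auto simp: N_def atLeast0LessThan)
  define \<psi> where "\<psi> = the_inv_into Z \<phi>"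
  have \<psi>: "\<psi> (\<phi> z) = z" if "z \<in> Z" for z
    using \<phi> that by (simp add: \<psi>_def the_inv_into_f_f bij_betw_def)
  have \<phi>N: "\<phi> z < N" if "z \<in> Z" for z
    using \<phi> that by (auto simp: bij_betw_def)
  define e :: "bool list \<Rightarrow> 'z \<Rightarrow> 'a" where "e x z = (\<Sum>j<n. of_bool (x ! j) * f j z)" for x z
  define C where "C x = map (\<lambda>q. L (e x (\<psi> q))) [0..<N]" for x
  define js where "js i z = map (\<lambda>l. \<phi> (shift i l z)) [0..<k]" for i z
  define A where "A i = map_pmf (\<lambda>z. xor_alg (js i z) False) (pmf_of_set (Y i))" for i
  have finY: "finite (Y i)" if "i < n" for i using Y(1)[OF that] Z finite_subset by blast
  have L0: "\<not> L 0" using L(1)[of 0 0] by simp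
  have C_in: "C \<in> binary_strings n \<rightarrow> binary_strings (card Z)"
    by (auto simp: binary_strings_def C_def N_def)
  have "locally_decodable k (1 / (4 * real k * real p)) (1 / 4) n N C"
    unfolding locally_decodable_def
  proof (intro exI[of _ A] conjI allI impI ballI)
    fix i T y assume i: "i < n" and T: "T \<in> set_pmf (A i)"
    then obtain z where z: "z \<in> Y i" "T = xor_alg (js i z) False"
      by (auto simp: A_def set_pmf_of_set[OF Y(2)[OF i] finY[OF i]])
    show "length (queries T y) \<le> k" by (simp add: z js_def)
    show "set (queries T y) \<subseteq> {..<N}"
      using into[OF i _ z(1)] \<phi>N by (auto simp: z(2) js_def)
  next
    fix x i y
    assume i: "i < n" and y: "y \<in> binary_strings N"
      and dist: "real (hamming_dist (C x) y) \<le> 1 / (4 * real k * real p) * real N"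
    define D where "D = {q. q < N \<and> C x ! q \<noteq> y ! q}"
    have D: "hamming_dist (C x) y = card D"
      by (simp add: hamming_dist_def D_def C_def)
    \<comment> \<open>The starting points for which at least one query hits a corrupted
      position.\<close>
    define bad where "bad = (\<Union>l<k. {z \<in> Y i. \<phi> (shift i l z) \<in> D})"
    have bad_sub: "bad \<subseteq> Y i" by (auto simp: bad_def)
    have "card bad \<le> (\<Sum>l<k. card {z \<in> Y i. \<phi> (shift i l z) \<in> D})"
      unfolding bad_def by (rule card_UN_le) simp
    also have "\<dots> \<le> (\<Sum>l<k. card D)"
    proof (rule sum_mono)
      fix l assume l: "l \<in> {..<k}"
      show "card {z \<in> Y i. \<phi> (shift i l z) \<in> D} \<le> card D"
      proof (rule card_inj_on_le)
        show "inj_on (\<lambda>z. \<phi> (shift i l z)) {z \<in> Y i. \<phi> (shift i l z) \<in> D}"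
          using inj[OF i, of l] into[OF i, of l] l \<phi>
          by (auto simp: inj_on_def bij_betw_def)
      qed (auto simp: D_def)
    qed
    finally have "card bad \<le> k * card D" by simp
    then have "real (card bad) \<le> real k * real (card D)"
      by (metis of_nat_le_iff of_nat_mult)
    also have "\<dots> \<le> real k * (1 / (4 * real k * real p) * real N)"
      using dist D by (intro mult_left_mono) auto
    also have "\<dots> = real N / (4 * p)" using kp by simp
    also have "\<dots> \<le> real (p * card (Y i)) / (4 * p)"
      using Y(3)[OF i] unfolding N_def by (intro divide_right_mono) (auto simp del: of_nat_mult)
    also have "\<dots> = real (card (Y i)) / 4" using kp by simp
    finally have bad: "real (card bad) \<le> real (card (Y i)) / 4" .
    have good: "run (xor_alg (js i z) False) y = x ! i" if z: "z \<in> Y i - bad" for z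
    proof -
      have "run (xor_alg (js i z) False) y \<longleftrightarrow> L (\<Sum>j\<leftarrow>js i z. e x (\<psi> j))"
      proof (subst run_xor_alg_functional[where L = L and v = "\<lambda>j. e x (\<psi> j)"])
        fix q assume "q \<in> set (js i z)"
        then obtain l where l: "l < k" "q = \<phi> (shift i l z)" by (auto simp: js_def)
        then have "q < N" using into[OF i l(1)] z \<phi>N by auto
        moreover have "q \<notin> D" using z l by (auto simp: bad_def)
        ultimately show "y ! q = L (e x (\<psi> q))" by (auto simp: D_def C_def)
      qed (use L in auto)
      also have "(\<Sum>j\<leftarrow>js i z. e x (\<psi> j)) = (\<Sum>l<k. e x (\<psi> (\<phi> (shift i l z))))"
        by (simp add: js_def o_def interv_sum_list_conv_sum_set_nat atLeast0LessThan)
      also have "\<dots> = (\<Sum>l<k. e x (shift i l z))"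
        using into[OF i] z \<psi> by (intro sum.cong) auto
      \<comment> \<open>Exchanging the sums isolates the decoding identity for each message bit,
        which annihilates all bits but the one at \<open>i\<close>.\<close>
      also have "\<dots> = (\<Sum>j<n. of_bool (x ! j) * (\<Sum>l<k. f j (shift i l z)))"
        unfolding e_def by (subst sum.swap) (simp add: sum_distrib_left)
      also have "\<dots> = (\<Sum>j<n. if j = i then of_bool (x ! j) else 0)"
        using decode[OF i _, of _ z] z by (intro sum.cong) auto
      also have "\<dots> = of_bool (x ! i)" using i by simp
      finally show ?thesis using L(2) L0 by (cases "x ! i") auto
    qed
    have "measure_pmf.prob (A i) {T. run T y = x ! i}
        = measure_pmf.prob (pmf_of_set (Y i)) {z. run (xor_alg (js i z) False) y = x ! i}"
      unfolding A_def by (simp add: vimage_def)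
    also have "\<dots> \<ge> measure_pmf.prob (pmf_of_set (Y i)) (Y i - bad)"
      using good by (intro measure_pmf.finite_measure_mono) auto
    finally have "card (Y i - bad) / card (Y i) \<le> measure_pmf.prob (A i) {T. run T y = x ! i}"
      using bad_sub by (simp add: measure_pmf_of_set[OF Y(2)[OF i] finY[OF i]] Int_absorb1 Diff_subset Int_commute)
    moreover have "real (card (Y i - bad)) = real (card (Y i)) - real (card bad)"
      using finY[OF i] bad_sub
      by (simp add: card_Diff_subset finite_subset card_mono)
    moreover have pos: "real (card (Y i)) > 0" using finY Y(2) i by (simp add: card_gt_0_iff)
    ultimately have "1 - card bad / card (Y i) \<le> measure_pmf.prob (A i) {T. run T y = x ! i}"
      by (simp add: diff_divide_distrib)
    moreover have "card bad / card (Y i) \<le> 1 / 4"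
      using bad pos by (simp add: divide_le_eq)
    ultimately show "measure_pmf.prob (A i) {T. run T y = x ! i} \<ge> 1 - 1 / 4"
      by linarith
  qed
  then show ?thesis using C_in by (auto simp: N_def)
qed

subsection \<open>Matching vectors\<close>

lemma digits_eq_imp_eq:
  fixes i j r :: nat
  assumes "i < r ^ w" "j < r ^ w" "\<And>c. c < w \<Longrightarrow> i div r ^ c mod r = j div r ^ c mod r"
  shows "i = j"
  using assms
proof (induction w arbitrary: i j)
  case (Suc w)
  have "i div r = j div r"
  proof (rule Suc.IH)
    show "i div r < r ^ w" "j div r < r ^ w"
      using Suc.prems by (auto intro: less_mult_imp_div_less simp: mult.commute)
    show "i div r div r ^ c mod r = j div r div r ^ c mod r" if "c < w" for c
      using Suc.prems(3)[of "Suc c"] that by (simp add: div_mult2_eq)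
  qed
  moreover have "i mod r = j mod r" using Suc.prems(3)[of 0] by simp
  ultimately show ?case by (metis div_mult_mod_eq)
qed simp

text \<open>Indices are written with \<open>w\<close> digits in base \<open>r\<close>. A one-hot
  encoding of the digits with an extra coordinate 1 has inner products 1 + (number of agreeing
  digits), and the \<open>e\<close>-th tensor power raises these to the power \<open>e\<close>. For
  w + 1 = p the norms vanish modulo p. At \<open>x0\<close> every vector is 1.\<close>

lemma ex_matching_vectors:
  fixes w r e :: nat
  shows "\<exists>I x0 u. finite (I :: (nat \<Rightarrow> (nat \<times> nat) option) set) \<and> card I = (w * r + 1) ^ e \<and> x0 \<in> I \<and>
     (\<forall>j. u j x0 = (1::nat)) \<and>
     (\<forall>i < r ^ w. \<forall>j < r ^ w. \<exists>m \<le> w. (m = w \<longleftrightarrow> i = j) \<and> (\<Sum>x\<in>I. u i x * u j x) = (m + 1) ^ e)"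
proof -
  define d where "d j c = j div r ^ c mod r" for j c
  define B where "B = insert None (Some ` ({..<w} \<times> {..<r}))"
  define b :: "nat \<Rightarrow> (nat \<times> nat) option \<Rightarrow> nat" where
    "b j q = (case q of None \<Rightarrow> 1 | Some (c, s) \<Rightarrow> of_bool (d j c = s))" for j q
  \<comment> \<open>Coordinates of the tensor power: \<open>e\<close>-tuples of basic
    coordinates.\<close>
  define I where "I = PiE {..<e} (\<lambda>_. B)"
  define x0 where "x0 = (\<lambda>l\<in>{..<e}. None :: (nat \<times> nat) option)"
  define u where "u j x = (\<Prod>l<e. b j (x l))" for j x
  have finB: "finite B" by (simp add: B_def)
  have cardB: "card B = w * r + 1"
    by (auto simp: B_def card_insert_if card_image)
  have finX: "finite I" unfolding I_def by (intro finite_PiE finB) auto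
  have cardX: "card I = (w * r + 1) ^ e" by (simp add: I_def card_PiE cardB)
  have x0: "x0 \<in> I" by (auto simp: I_def x0_def B_def)
  have u0: "u j x0 = 1" for j by (simp add: u_def x0_def b_def)
  have inner: "\<exists>m \<le> w. (m = w \<longleftrightarrow> i = j) \<and> (\<Sum>x\<in>I. u i x * u j x) = (m + 1) ^ e"
    if ij: "i < r ^ w" "j < r ^ w" for i j
  proof (intro exI[of _ "card {c \<in> {..<w}. d i c = d j c}"] conjI)
    define M where "M = {c \<in> {..<w}. d i c = d j c}"
    show "card {c \<in> {..<w}. d i c = d j c} \<le> w"
      using card_mono[of "{..<w}" "{c \<in> {..<w}. d i c = d j c}"] by auto
    show "card {c \<in> {..<w}. d i c = d j c} = w \<longleftrightarrow> i = j"
    proof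
      assume "card {c \<in> {..<w}. d i c = d j c} = w"
      then have "{c \<in> {..<w}. d i c = d j c} = {..<w}"
        by (intro card_subset_eq) auto
      then have "d i c = d j c" if "c < w" for c using that by blast
      then show "i = j" using digits_eq_imp_eq[OF ij] by (simp add: d_def)
    qed auto
    have "(\<Sum>q\<in>B. b i q * b j q) = 1 + (\<Sum>(c, s)\<in>{..<w} \<times> {..<r}. of_bool (d i c = s) * of_bool (d j c = s))"
      by (auto simp: B_def b_def sum.reindex split_beta)
    also have "(\<Sum>(c, s)\<in>{..<w} \<times> {..<r}. of_bool (d i c = s) * of_bool (d j c = s))
        = (\<Sum>c<w. \<Sum>s<r. if s = d i c then of_bool (d j c = s) else (0::nat))"
      by (subst sum.cartesian_product[symmetric]) (intro sum.cong refl, auto)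
    also have "\<dots> = (\<Sum>c<w. of_bool (d i c = d j c))"
    proof (rule sum.cong[OF refl])
      fix c assume c: "c \<in> {..<w}"
      have "r > 0" using ij c by (cases "r = 0") (auto simp: power_0_left)
      then have "d i c < r" by (simp add: d_def)
      then show "(\<Sum>s<r. if s = d i c then of_bool (d j c = s) else (0::nat)) = of_bool (d i c = d j c)"
        by (simp add: eq_commute)
    qed
    also have "\<dots> = card M" by (simp add: M_def sum_of_bool_eq Int_def)
    finally have "(\<Sum>q\<in>B. b i q * b j q) = card M + 1" by simp
    moreover have "(\<Sum>x\<in>I. u i x * u j x) = (\<Prod>l<e. \<Sum>q\<in>B. b i q * b j q)"
      unfolding I_def u_def by (subst prod_sum_PiE) (auto simp: finB prod.distrib)
    ultimately show "(\<Sum>x\<in>I. u i x * u j x) = (card {c \<in> {..<w}. d i c = d j c} + 1) ^ e"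
      by (simp add: M_def)
  qed
  show ?thesis
    by (rule exI[of _ I], rule exI[of _ x0], rule exI[of _ u])
       (use finX cardX x0 u0 inner in blast)
qed

text \<open>The power on the left is a root of X^t - 1 modulo \<open>p\<close>, where t is the order
  of \<open>g\<close>. There are at most t such roots, and the powers of \<open>g\<close> already
  supply t of them.\<close>

lemma power_index_in_powers:
  fixes p g m :: nat
  assumes p: "prime p" and g: "coprime p g" and m: "0 < m" "m < p"
  shows "\<exists>b. [m ^ ((p - 1) div ord p g) = g ^ b] (mod p)"
proof -
  define t where "t = ord p g"
  have t: "t > 0" using g by (simp add: t_def)
  have "\<not> p dvd m" using m by (auto dest: dvd_imp_le)
  have "t dvd p - 1"
    using order_divides_totient[OF g] totient_prime[OF p] by (simp add: t_def)
  then have te: "((p - 1) div t) * t = p - 1" by simp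
  define S where "S = {x \<in> {..<p}. [x ^ t = 1] (mod p)}"
  have sub: "(\<lambda>k. g ^ k mod p) ` {..<t} \<subseteq> S"
  proof clarify
    fix k
    have "[(g ^ k mod p) ^ t = (g ^ t) ^ k] (mod p)"
      by (simp add: cong_def power_mod flip: power_mult) (simp add: mult.commute)
    also have "[(g ^ t) ^ k = 1 ^ k] (mod p)"
      unfolding t_def by (intro cong_pow ord)
    finally show "g ^ k mod p \<in> S" using p by (simp add: S_def prime_gt_0_nat)
  qed
  have "card S \<le> t" unfolding S_def by (rule roots_mod_prime_bound[OF p t])
  also have "t = card ((\<lambda>k. g ^ k mod p) ` {..<t})"
    using inj_power_mod[OF g] by (simp add: card_image t_def)
  finally have eq: "(\<lambda>k. g ^ k mod p) ` {..<t} = S"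
    by (intro card_seteq sub) (simp_all add: S_def)
  have "[(m ^ ((p - 1) div t) mod p) ^ t = m ^ (((p - 1) div t) * t)] (mod p)"
    by (simp add: cong_def power_mod power_mult)
  also have "[m ^ (((p - 1) div t) * t) = 1] (mod p)"
    using fermat_theorem[OF p \<open>\<not> p dvd m\<close>] by (simp only: te)
  finally have "m ^ ((p - 1) div t) mod p \<in> S" using p by (simp add: S_def prime_gt_0_nat)
  then obtain b where "m ^ ((p - 1) div t) mod p = g ^ b mod p" using eq by blast
  then show ?thesis by (auto simp: cong_def t_def)
qed

subsection \<open>The codes\<close>

lemma power_cong_root_of_unity:
  fixes z :: "'a::monoid_mult"
  assumes "z ^ p = 1" "[m = n] (mod p)"
  shows "z ^ m = z ^ n"
  using power_mod_root_of_unity[OF assms(1)] assms(2) by (metis cong_def)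

text \<open>The coefficient at \<open>x0\<close> is 1, so that coordinate can be adjusted to land on
  the hyperplane. Remembering its old value makes the adjustment injective.\<close>

lemma card_hyperplane_mod:
  fixes u :: "'x \<Rightarrow> nat"
  assumes p: "p > 0" and fin: "finite I" and x0: "x0 \<in> I" "u x0 = 1"
  shows "card (PiE I (\<lambda>_. {..<p})) \<le> p * card {v \<in> PiE I (\<lambda>_. {..<p}). p dvd (\<Sum>x\<in>I. u x * v x)}"
proof -
  define Z where "Z = PiE I (\<lambda>_. {..<p})"
  define H where "H = {v \<in> Z. p dvd (\<Sum>x\<in>I. u x * v x)}"
  define R where "R v = (\<Sum>x\<in>I - {x0}. u x * v x)" for v
  \<comment> \<open>The factor p - 1 plays the role of -1 modulo \<open>p\<close> in the natural
    numbers.\<close>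
  define h where "h v = (v(x0 := R v * (p - 1) mod p), v x0)" for v
  have finZ: "finite Z" unfolding Z_def using fin by (intro finite_PiE) auto
  have "inj_on h Z"
  proof (rule inj_onI)
    fix v w assume *: "v \<in> Z" "w \<in> Z" "h v = h w"
    have "v x = w x" for x
    proof (cases "x = x0")
      case False
      then show ?thesis using *(3) by (auto simp: h_def fun_upd_def dest: fun_cong[of _ _ x])
    qed (use * in \<open>simp add: h_def\<close>)
    then show "v = w" by blast
  qed
  moreover have "h ` Z \<subseteq> H \<times> {..<p}"
  proof clarify
    fix v a b assume v: "v \<in> Z" and ab: "(a, b) = h v"
    have a: "a = v(x0 := R v * (p - 1) mod p)" and b: "b = v x0" using ab by (auto simp: h_def)
    have "a \<in> Z"
      using v x0 p unfolding a Z_def by (auto simp: PiE_def extensional_def Pi_def)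
    have "(\<Sum>x\<in>I. u x * a x) = a x0 + (\<Sum>x\<in>I - {x0}. u x * a x)"
      using x0 by (subst sum.remove[OF fin x0(1)]) simp
    also have "(\<Sum>x\<in>I - {x0}. u x * a x) = R v"
      unfolding R_def by (intro sum.cong) (auto simp: a)
    finally have s: "(\<Sum>x\<in>I. u x * a x) = R v * (p - 1) mod p + R v" by (simp add: a)
    have "[R v * (p - 1) mod p + R v = R v * (p - 1) + R v] (mod p)"
      by (simp add: cong_def mod_simps)
    also have "R v * (p - 1) + R v = p * R v"
      using p by (cases p) (auto simp: algebra_simps)
    finally have "p dvd (\<Sum>x\<in>I. u x * a x)" unfolding s
      by (simp add: cong_dvd_iff)
    moreover have "b < p" using v x0 by (auto simp: b Z_def)
    ultimately show "a \<in> H \<and> b \<in> {..<p}" using \<open>a \<in> Z\<close> by (simp add: H_def)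
  qed
  ultimately have "card Z \<le> card (H \<times> {..<p})"
    using finZ by (intro card_inj_on_le) (auto simp: H_def)
  then show ?thesis by (simp add: card_cartesian_product mult.commute H_def Z_def)
qed

text \<open>Shifting v by \<open>a l\<close> times the \<open>i\<close>-th vector multiplies the
  \<open>j\<close>-th symbol by \<open>z ^ (a l * g)\<close>, with g the inner product of vectors
  \<open>i\<close> and \<open>j\<close>. The zero sum then cancels every \<open>j\<close> other than
  \<open>i\<close>.\<close>

lemma ex_locally_decodable_code:
  fixes z :: "gf2 alg_closure" and a :: "nat \<Rightarrow> nat"
  assumes p: "prime p" "p \<ge> 3" and z: "z ^ p = 1"
    and k: "odd k" and sum0: "(\<Sum>l<k. z ^ a l) = 0"
    and n: "n \<le> r ^ (p - 1)"
  shows "\<exists>C \<in> binary_strings n \<rightarrow> binary_strings (p ^ (((p - 1) * r + 1) ^ ((p - 1) div ord p 2))).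
           locally_decodable k (1 / (4 * real k * real p)) (1 / 4) n
             (p ^ (((p - 1) * r + 1) ^ ((p - 1) div ord p 2))) C"
proof -
  define e where "e = (p - 1) div ord p 2"
  have "odd p" using prime_odd_nat[OF p(1)] p(2) by auto
  then have cop: "coprime p 2" by simp
  have "ord p 2 dvd p - 1"
    using order_divides_totient[OF cop] totient_prime[OF p(1)] by simp
  moreover have "ord p 2 > 0" using cop by simp
  \<comment> \<open>Positivity is what makes the norm \<open>p ^ e\<close> divisible by
    \<open>p\<close>.\<close>
  ultimately have e: "e > 0"
    using p dvd_imp_le[of "ord p 2" "p - 1"] by (simp add: e_def div_greater_zero_iff)
  obtain I :: "(nat \<Rightarrow> (nat \<times> nat) option) set" and x0 u where I: "finite I" "card I = ((p - 1) * r + 1) ^ e" "x0 \<in> I"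
    and u0: "\<And>j. u j x0 = (1::nat)"
    and inner: "\<And>i j. i < r ^ (p - 1) \<Longrightarrow> j < r ^ (p - 1) \<Longrightarrow> \<exists>m \<le> p - 1. (m = p - 1 \<longleftrightarrow> i = j) \<and>
           (\<Sum>x\<in>I. u i x * u j x) = (m + 1) ^ e"
    using ex_matching_vectors[of "p - 1" r e] by (elim exE conjE) blast
  define Z where "Z = PiE I (\<lambda>_. {..<p})"
  define ip where "ip j v = (\<Sum>x\<in>I. u j x * v x)" for j v
  define f where "f j v = z ^ ip j v" for j v
  define shift where "shift i l v = (\<lambda>x\<in>I. (v x + a l * u i x) mod p)" for i l v
  \<comment> \<open>On this hyperplane the \<open>i\<close>-th symbol is 1, so the decoder recovers
    the bit itself, not a multiple by an unknown root of unity.\<close>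
  define Y where "Y i = {v \<in> Z. p dvd ip i v}" for i
  have p0: "p > 0" using p by simp
  have finZ: "finite Z" unfolding Z_def using I by (intro finite_PiE) auto
  have cardZ: "card Z = p ^ (((p - 1) * r + 1) ^ e)" by (simp add: Z_def card_PiE I)
  have cardY: "card Z \<le> p * card (Y i)" for i
    using card_hyperplane_mod[OF p0 I(1,3), of "u i"] u0 by (simp add: Z_def Y_def ip_def)
  have Yne: "Y i \<noteq> {}" for i
    using cardY[of i] p0 by (auto simp: cardZ)
  have ip_shift: "[ip j (shift i l v) = ip j v + a l * (\<Sum>x\<in>I. u i x * u j x)] (mod p)" for i j l v
  proof -
    have "[ip j (shift i l v) = (\<Sum>x\<in>I. u j x * (v x + a l * u i x))] (mod p)"
      unfolding ip_def shift_def by (intro cong_sum cong_mult) (auto simp: cong_def)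
    also have "(\<Sum>x\<in>I. u j x * (v x + a l * u i x)) = ip j v + a l * (\<Sum>x\<in>I. u i x * u j x)"
      by (simp add: ip_def distrib_left sum.distrib sum_distrib_left mult_ac)
    finally show ?thesis .
  qed
  have char: "CHAR(gf2 alg_closure) = 2" by (simp add: CHAR_gf2)
  have decode: "(\<Sum>l<k. f j (shift i l v)) = (if j = i then 1 else 0)"
    if "i < n" "j < n" "v \<in> Y i" for i j v
  proof -
    define g where "g = (\<Sum>x\<in>I. u i x * u j x)"
    have "(\<Sum>l<k. f j (shift i l v)) = (\<Sum>l<k. z ^ ip j v * z ^ (a l * g))"
      unfolding f_def power_add[symmetric] g_def
      by (intro sum.cong refl power_cong_root_of_unity[OF z] ip_shift)
    also have "\<dots> = z ^ ip j v * (\<Sum>l<k. z ^ (a l * g))" by (simp add: sum_distrib_left)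
    finally have eq: "(\<Sum>l<k. f j (shift i l v)) = z ^ ip j v * (\<Sum>l<k. z ^ (a l * g))" .
    have "i < r ^ (p - 1)" "j < r ^ (p - 1)" using that n by auto
    from inner[OF this] obtain m where m: "m \<le> p - 1" "m = p - 1 \<longleftrightarrow> i = j" "g = (m + 1) ^ e"
      unfolding g_def by blast
    show ?thesis
    proof (cases "j = i")
      case True
      then have "g = p ^ e" using m p by simp
      then have "[a l * g = 0] (mod p)" for l using e by (simp add: cong_0_iff)
      then have "z ^ (a l * g) = 1" for l
        using power_cong_root_of_unity[OF z, of "a l * g" 0] by simp
      moreover have "z ^ ip j v = 1"
        using power_cong_root_of_unity[OF z, of "ip j v" 0] that True by (simp add: Y_def cong_0_iff)
      \<comment> \<open>All \<open>k\<close> terms are 1 here, and an odd number of ones sums to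
        1.\<close>
      moreover have "of_nat k = (1 :: gf2 alg_closure)"
      proof -
        obtain q where "k = 2 * q + 1" using k by (elim oddE)
        then have "of_nat k = of_nat 2 * of_nat q + (1 :: gf2 alg_closure)" by simp
        then show ?thesis using of_nat_CHAR[where 'a = "gf2 alg_closure"] unfolding char by simp
      qed
      ultimately show ?thesis unfolding eq using True by simp
    next
      case False
      then have "0 < m + 1" "m + 1 < p" using m p by auto
      from power_index_in_powers[OF p(1) cop this]
      obtain b where b: "[g = 2 ^ b] (mod p)" by (auto simp: m(3) e_def)
      \<comment> \<open>Since g is a power of 2 modulo \<open>p\<close>, the sum is a Frobenius
        image of the zero sum.\<close>
      have "(\<Sum>l<k. z ^ (a l * g)) = (\<Sum>l<k. (z ^ a l) ^ (2 ^ b))"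
        unfolding power_mult[symmetric]
        by (intro sum.cong refl power_cong_root_of_unity[OF z] cong_mult b) auto
      also have "\<dots> = (\<Sum>l<k. z ^ a l) ^ (2 ^ b)"
        by (rule freshmans_dream_sum'[symmetric, where n = b]) (simp_all add: CHAR_gf2)
      also have "\<dots> = 0" by (simp add: sum0)
      finally show ?thesis unfolding eq using False by simp
    qed
  qed
  have into: "shift i l v \<in> Z" for i l v
    using p0 by (auto simp: shift_def Z_def)
  have inj: "inj_on (shift i l) (Y i)" for i l
  proof (rule inj_onI)
    fix v w assume *: "v \<in> Y i" "w \<in> Y i" "shift i l v = shift i l w"
    have vw: "v \<in> Z" "w \<in> Z" using * by (auto simp: Y_def)
    show "v = w"
    proof (rule PiE_ext[OF vw[unfolded Z_def]])
      fix x assume x: "x \<in> I"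
      then have "[v x + a l * u i x = w x + a l * u i x] (mod p)"
        using fun_cong[OF *(3), of x] by (simp add: shift_def cong_def)
      then have "[v x = w x] (mod p)" by (simp only: cong_add_rcancel_nat)
      moreover have "v x < p" "w x < p" using vw x by (auto simp: Z_def)
      ultimately show "v x = w x" by (simp add: cong_less_modulus_unique_nat)
    qed
  qed
  obtain L :: "gf2 alg_closure \<Rightarrow> bool" where L: "L 1" "\<And>x y. L (x + y) \<longleftrightarrow> L x \<noteq> L y"
    using ex_parity_functional by blast
  have "\<exists>C \<in> binary_strings n \<rightarrow> binary_strings (card Z).
           locally_decodable k (1 / (4 * real k * real p)) (1 / 4) n (card Z) C"
    by (rule locally_decodable_of_shifts[where L = L and Y = Y and f = f and shift = shift])
       (use L finZ k p0 cardY Yne decode into inj in \<open>auto simp: Y_def odd_pos\<close>)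
  then show ?thesis by (simp add: cardZ e_def)
qed

section \<open>Choice of parameters and the length estimate\<close>

theorem theorem15:
  fixes \<gamma> :: real
  assumes "\<gamma> > 0"
    and "infinite {t::nat. t > 0 \<and>
           real (largest_prime_factor (2 ^ t - 1)) > 2 powr (\<gamma> * real t)}"
  shows "\<exists>k::nat. \<forall>\<eta>::real. \<eta> > 0 \<longrightarrow>
           (\<exists>c \<delta> \<epsilon> :: real. c > 0 \<and> \<delta> > 0 \<and> \<epsilon> < 1 / 2 \<and>
             (\<forall>n::nat. n \<ge> 1 \<longrightarrow>
               (\<exists>(N::nat) (C :: bool list \<Rightarrow> bool list).
                  C \<in> binary_strings n \<rightarrow> binary_strings N \<and>
                  real N \<le> exp (c * real n powr \<eta>) \<and>
                  locally_decodable k \<delta> \<epsilon> n N C)))"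
proof -
  \<comment> \<open>Chosen so that p > 2^(\<gamma> t) implies \<open>2 ^ t \<le> p ^ s\<close>. It
    depends on \<gamma> only, so \<open>k\<close> is fixed before \<eta>.\<close>
  define s where "s = nat \<lceil>1 / \<gamma>\<rceil>"
  define k where "k = 12 * (growth_steps (3 * s))\<^sup>2 + 1"
  have s: "1 \<le> \<gamma> * real s"
  proof -
    have "1 / \<gamma> \<le> real s" unfolding s_def by (rule real_nat_ceiling_ge)
    then show ?thesis using assms(1) by (simp add: field_simps)
  qed
  have k: "odd k" by (simp add: k_def)
  show ?thesis
  proof (intro exI[of _ k] allI impI)
    fix \<eta> :: real assume \<eta>: "\<eta> > 0"
    \<comment> \<open>For such t, \<gamma> t \<eta> \<ge> 1; as the order \<open>d\<close> of 2
      modulo \<open>p\<close> exceeds \<gamma> t, the length exponent 1 / d is at most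
      \<eta>.\<close>
    obtain t where t: "t > nat \<lceil>1 / (\<gamma> * \<eta>)\<rceil>" "t > 0"
      "real (largest_prime_factor (2 ^ t - 1)) > 2 powr (\<gamma> * real t)"
      using assms(2) unfolding infinite_nat_iff_unbounded by blast
    define p where "p = largest_prime_factor (2 ^ t - 1)"
    have large: "real p > 2 powr (\<gamma> * real t)" using t(3) by (simp add: p_def)
    have "2 powr (\<gamma> * real t) \<ge> 1" using assms(1) by (intro ge_one_powr_ge_zero) auto
    then have "p > 1" using large by simp
    \<comment> \<open>p > 1 excludes the degenerate case in which the largest prime factor is 1 by
      convention.\<close>
    then have gt1: "(2::nat) ^ t - 1 > 1"
      unfolding p_def largest_prime_factor_def by (auto split: if_splits)
    then have "p = Max (prime_factors (2 ^ t - 1))"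
      by (simp add: p_def largest_prime_factor_def)
    moreover have "prime_factors (2 ^ t - 1 :: nat) \<noteq> {}"
      using gt1 by (auto simp: prime_factorization_empty_iff)
    ultimately have pf: "p \<in> prime_factors (2 ^ t - 1)"
      by (metis Max_in finite_set_mset)
    then have p: "prime p" "p dvd 2 ^ t - 1" by auto
    have "odd (2 ^ t - 1 :: nat)" using t(2) by simp
    then have "odd p" using p(2) dvd_trans by blast
    then have p3: "p \<ge> 3" using \<open>p > 1\<close> by (cases "p = 2") auto
    have cop: "coprime p 2" using \<open>odd p\<close> by simp
    define d where "d = ord p 2"
    have d0: "d > 0" using cop by (simp add: d_def)
    have dp: "d dvd p - 1"
      using order_divides_totient[OF cop] totient_prime[OF p(1)] by (simp add: d_def)
    have "[2 ^ d = 1] (mod p)" unfolding d_def by (rule ord)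
    then have "p dvd 2 ^ d - 1"
      by (metis cong_altdef_nat' cong_to_1_nat)
    then have "p \<le> 2 ^ d - 1" using d0 one_less_power[of "2::nat" d] by (intro dvd_imp_le) auto
    then have "real p < 2 ^ d"
      by (metis Suc_pred' less_Suc_eq_le of_nat_less_iff of_nat_numeral of_nat_power pos2 zero_less_power)
    moreover have "2 powr real d = (2::real) ^ d" by (simp add: powr_realpow)
    ultimately have "2 powr (\<gamma> * real t) < 2 powr real d"
      using large by linarith
    then have dt: "\<gamma> * real t < real d" by simp
    have "1 / (\<gamma> * \<eta>) \<le> real t"
      using real_nat_ceiling_ge[of "1 / (\<gamma> * \<eta>)"] t(1) by linarith
    then have "1 \<le> (\<gamma> * real t) * \<eta>" using assms(1) \<eta> by (simp add: field_simps)
    also have "\<dots> \<le> real d * \<eta>" using dt \<eta> by (intro mult_right_mono) auto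
    finally have d\<eta>: "1 / real d \<le> \<eta>" using d0 by (simp add: field_simps)
    have "2 ^ t \<le> p ^ s"
    proof -
      have "(2::real) ^ t = 2 powr (real t * 1)" by (simp add: powr_realpow)
      also have "\<dots> \<le> 2 powr (real t * (\<gamma> * real s))"
        using s by (intro powr_mono mult_left_mono) auto
      also have "\<dots> = (2 powr (\<gamma> * real t)) ^ s"
        by (simp add: powr_powr mult_ac flip: powr_realpow)
      also have "\<dots> \<le> real p ^ s" using large by (intro power_mono) auto
      finally show ?thesis by (metis of_nat_le_iff of_nat_numeral of_nat_power)
    qed
    obtain z :: "gf2 alg_closure" where z: "z \<noteq> 1" "z ^ p = 1"
      using ex_nontrivial_root_of_unity[OF \<open>odd p\<close> \<open>p > 1\<close>] by blast
    obtain a where a: "(\<Sum>l<k. z ^ a l) = 0"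
      using ex_odd_zero_sum_of_roots[OF _ p(1) p3 p(2) t(2) \<open>2 ^ t \<le> p ^ s\<close> z]
      unfolding k_def by (auto simp: CHAR_gf2)
    define w where "w = p - 1"
    define e where "e = w div d"
    have w: "w > 0" "w = d * e" using p3 dp by (auto simp: w_def e_def)
    define c where "c = ln p * (2 * w + 1) ^ e"
    have "c > 0" using p3 by (simp add: c_def)
    moreover have "1 / (4 * real k * real p) > (0::real)" using p3 k by (simp add: odd_pos)
    moreover have "\<exists>N C. C \<in> binary_strings n \<rightarrow> binary_strings N \<and>
        real N \<le> exp (c * real n powr \<eta>) \<and> locally_decodable k (1 / (4 * real k * real p)) (1 / 4) n N C"
      if n: "n \<ge> 1" for n
    proof -
      \<comment> \<open>The base r is x = n^(1/w) rounded up, so \<open>w\<close> digits suffice for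
        n indices. As x \<ge> 1, rounding costs at most a factor 2, and the dimension
        \<open>(w * r + 1) ^ e\<close> is at most a constant times n^(e/w) = n^(1/d).\<close>
      define x where "x = real n powr (1 / w)"
      define r where "r = nat \<lceil>x\<rceil>"
      have x1: "x \<ge> 1" using n by (simp add: x_def ge_one_powr_ge_zero)
      have xr: "x \<le> real r" unfolding r_def by (rule real_nat_ceiling_ge)
      have rx: "real r \<le> 2 * x" using x1 unfolding r_def by linarith
      have x_pow: "x ^ q = real n powr (q / w)" for q
      proof -
        have "x ^ q = x powr real q" using x1 by (simp add: powr_realpow)
        also have "\<dots> = real n powr (q / w)" unfolding x_def powr_powr by simp
        finally show ?thesis .
      qed
      have "real n = x ^ w" using n w(1) unfolding x_pow by simp
      also have "\<dots> \<le> real r ^ w" using x1 xr by (intro power_mono) auto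
      finally have nr: "n \<le> r ^ w" by (metis of_nat_le_iff of_nat_power)
      define N where "N = p ^ ((w * r + 1) ^ e)"
      have "n \<le> r ^ (p - 1)" using nr by (simp only: w_def)
      from ex_locally_decodable_code[OF p(1) p3 z(2) k a this]
      have "\<exists>C \<in> binary_strings n \<rightarrow> binary_strings N.
          locally_decodable k (1 / (4 * real k * real p)) (1 / 4) n N C"
        by (simp only: N_def w_def e_def d_def)
      then obtain C where C: "C \<in> binary_strings n \<rightarrow> binary_strings N"
        "locally_decodable k (1 / (4 * real k * real p)) (1 / 4) n N C" by blast
      have "real (w * r + 1) \<le> (2 * w + 1) * x"
      proof -
        have "real w * real r \<le> real w * (2 * x)" using rx by (intro mult_left_mono) auto
        then show ?thesis using x1 by (simp add: algebra_simps)
      qed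
      then have "real (w * r + 1) ^ e \<le> ((2 * w + 1) * x) ^ e" by (intro power_mono) auto
      also have "\<dots> = (2 * w + 1) ^ e * x ^ e" by (simp add: power_mult_distrib)
      also have "x ^ e = real n powr (1 / d)"
        using w unfolding x_pow by simp
      also have "(2 * w + 1) ^ e * \<dots> \<le> (2 * w + 1) ^ e * real n powr \<eta>"
        using n d\<eta> by (intro mult_left_mono powr_mono) auto
      finally have M: "real (w * r + 1) ^ e \<le> (2 * w + 1) ^ e * real n powr \<eta>" by simp
      have "real N = exp (ln p * real (w * r + 1) ^ e)"
      proof -
        have "exp (ln p * real (w * r + 1) ^ e) = exp (real ((w * r + 1) ^ e) * ln p)"
          by (simp only: of_nat_power mult.commute)
        also have "\<dots> = real p ^ ((w * r + 1) ^ e)"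
          unfolding exp_of_nat_mult using p3 by simp
        finally show ?thesis by (simp only: N_def of_nat_power)
      qed
      also have "\<dots> \<le> exp (c * real n powr \<eta>)"
        using mult_left_mono[OF M, of "ln p"] p3 by (simp add: c_def mult.assoc)
      finally show ?thesis using C by blast
    qed
    ultimately show "\<exists>c \<delta> \<epsilon> :: real. c > 0 \<and> \<delta> > 0 \<and> \<epsilon> < 1 / 2 \<and>
             (\<forall>n::nat. n \<ge> 1 \<longrightarrow>
               (\<exists>(N::nat) (C :: bool list \<Rightarrow> bool list).
                  C \<in> binary_strings n \<rightarrow> binary_strings N \<and>
                  real N \<le> exp (c * real n powr \<eta>) \<and>
                  locally_decodable k \<delta> \<epsilon> n N C))"
      by - (rule exI[of _ c], rule exI[of _ "1 / (4 * real k * real p)"], rule exI[of _ "1 / 4"], auto)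
  qed
qed

end
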